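(* Let $(X,d)$ be a hyperbolic, weakly geodesic and uniformly locally finite metric space endowed with an isometric action of a group $G$. Then there exists a $G$-equivariant map $(x,a)\mapsto\mu_x(a)$ from $X\times X$ to the space of probability measures on $X$ such that: (i) there exists a natural number $R$ such that for all $a$ and $x$ in $X$, the support of $\mu_x(a)$ is contained in the closed ball centered at $a$ of radius $R$; (ii) there exists $\epsilon>0$ such that, for every natural number $k$, there exists $C>0$ such that for all $x,x'$ and $a$ in $X$, if $d(x,x')\leq k$ then $\|\mu_x(a)-\mu_{x'}(a)\|_1\leq C\, e^{-\epsilon d(x,a)}$; (iii) there exists $\eta>0$ such that, if the distance $d(x,x')$ is sufficiently large (i.e. for all $x,x'\in X$ with $d(x,x')$ at least some constant), then the number of $a\in X$ such that the supports of $\mu_x(a)$ and $\mu_{x'}(a)$ are disjoint is at least $\eta\cdot d(x,x')$.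
   Context: Let $(X,d)$ be a metric space. For a real $\delta\ge 0$, $(X,d)$ is $\delta$-hyperbolic if for all $x_1,x_2,x_3,x_4\in X$, $$d(x_1,x_4)+d(x_2,x_3)\leq \max\big(d(x_1,x_2)+d(x_3,x_4),\,d(x_1,x_3)+d(x_2,x_4)\big)+\delta;$$ it is hyperbolic if it is $\delta$-hyperbolic for some real $\delta\geq 0$. For a real $\delta\geq 0$, $(X,d)$ is weakly $\delta$-geodesic if for all $x,y\in X$ and every real $s\in[0,d(x,y)+\delta]$ there exists $z\in X$ with $d(x,z)\leq s$ and $d(z,y)\leq d(x,y)-s+\delta$; it is weakly geodesic if it is weakly $\delta$-geodesic for some real $\delta\geq 0$. $(X,d)$ is uniformly locally finite if for every real $r\geq 0$ there is an integer $K$ such that every closed ball of radius $r$ contains at most $K$ points. $G$-equivariance means $\mu_{g x}(g a)=g_*\mu_x(a)$ for all $g\in G$, $x,a\in X$. For a signed measure $\nu$ on $X$ (viewed as a discrete set), $\|\nu\|_1=\sum_{y\in X}|\nu(\{y\})|$. *)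

theory Defs
  imports
    "HOL-Analysis.Analysis"
    "HOL-Probability.Probability_Mass_Function"
    "HOL-Algebra.Group_Action"
begin

definition delta_hyperbolic :: "real \<Rightarrow> 'a::metric_space itself \<Rightarrow> bool" where
  "delta_hyperbolic \<delta> _ \<longleftrightarrow>
    (\<forall>x1 x2 x3 x4 :: 'a.
      dist x1 x4 + dist x2 x3
        \<le> max (dist x1 x2 + dist x3 x4) (dist x1 x3 + dist x2 x4) + \<delta>)"

definition hyperbolic :: "'a::metric_space itself \<Rightarrow> bool" where
  "hyperbolic X \<longleftrightarrow> (\<exists>\<delta>\<ge>0. delta_hyperbolic \<delta> X)"

definition weakly_delta_geodesic :: "real \<Rightarrow> 'a::metric_space itself \<Rightarrow> bool" where
  "weakly_delta_geodesic \<delta> _ \<longleftrightarrow>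
    (\<forall>x y :: 'a. \<forall>s\<in>{0..dist x y + \<delta>}.
      \<exists>z. dist x z \<le> s \<and> dist z y \<le> dist x y - s + \<delta>)"

definition weakly_geodesic :: "'a::metric_space itself \<Rightarrow> bool" where
  "weakly_geodesic X \<longleftrightarrow> (\<exists>\<delta>\<ge>0. weakly_delta_geodesic \<delta> X)"

definition uniformly_locally_finite :: "'a::metric_space itself \<Rightarrow> bool" where
  "uniformly_locally_finite _ \<longleftrightarrow>
    (\<forall>r\<ge>0. \<exists>K::nat. \<forall>x :: 'a. finite (cball x r) \<and> card (cball x r) \<le> K)"

definition isometric_action ::
    "('g, 'm) monoid_scheme \<Rightarrow> ('g \<Rightarrow> 'a::metric_space \<Rightarrow> 'a) \<Rightarrow> bool" where
  "isometric_action G \<phi> \<longleftrightarrow>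
    group_action G UNIV \<phi> \<and>
    (\<forall>g\<in>carrier G. \<forall>x y. dist (\<phi> g x) (\<phi> g y) = dist x y)"

text \<open>
  A uniformly locally finite space is countable, so the probability measures on it,
  as a discrete space, are exactly the values of type \<open>'a pmf\<close>: the mass of a point is
  given by \<^const>\<open>pmf\<close>, the support by \<^const>\<open>set_pmf\<close>, and the push-forward by \<^const>\<open>map_pmf\<close>.
\<close>

definition equivariant ::
    "('g, 'm) monoid_scheme \<Rightarrow> ('g \<Rightarrow> 'a \<Rightarrow> 'a) \<Rightarrow> ('a \<Rightarrow> 'a \<Rightarrow> 'a pmf) \<Rightarrow> bool" where
  "equivariant G \<phi> \<mu> \<longleftrightarrow>
    (\<forall>g\<in>carrier G. \<forall>x a. \<mu> (\<phi> g x) (\<phi> g a) = map_pmf (\<phi> g) (\<mu> x a))"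

text \<open>
  A signed measure on a countable discrete set is represented by its point masses.
  The sum below converges for differences of two \<^const>\<open>pmf\<close>'s, the only case used.
\<close>

definition l1_norm :: "('a \<Rightarrow> real) \<Rightarrow> real" where
  "l1_norm \<nu> = (\<Sum>\<^sub>\<infinity>y. \<bar>\<nu> y\<bar>)"

end

theory Submission
  imports Defs
begin

text \<open>
  Fix \<open>a\<close> and let a point \<open>x\<close> flow towards \<open>a\<close> by a random walk: cut the space around \<open>a\<close> into
  levels of width \<open>step\<close>, a fixed multiple of the hyperbolicity constant \<open>\<delta>\<close>, and jump
  from one level to a uniformly chosen point of the next lower level that lies within \<open>2 * \<delta>\<close> of
  being on a geodesic from \<open>a\<close> to the current point. The law of the point at which the walk
  reaches level \<open>1\<close> is \<open>\<mu>\<^sub>x(a)\<close>. All choices are uniform over sets defined by the distance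
  alone, so equivariance is automatic, and (i) holds because level \<open>1\<close> is near \<open>a\<close>. (If \<open>x\<close> itself is
  closer to \<open>a\<close> than \<open>step\<close>, the walk does not move.)

  For (ii), hyperbolicity makes the walk forget its starting point. Walks from \<open>x\<close> and \<open>x'\<close>
  stay near the geodesics to \<open>a\<close> (\<open>chain_step\<close>), hence are
  uniformly close to each other below the level given by the Gromov product of \<open>x\<close> and \<open>x'\<close>
  based at \<open>a\<close>. Once two walks are close, the sets from which their next points are chosen have a
  common point (\<open>near_geod_meet\<close>) and boundedly many elements, so even independent walks
  coincide at the next level with probability at least \<open>1 / K\<^sup>2\<close>. The \<open>\<ell>\<^sup>1\<close>-distance
  of the laws therefore shrinks by a constant factor at every further level
  (\<open>flow_contraction\<close>), that is, exponentially in \<open>d(x, a)\<close>.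

  For (iii), let \<open>a\<close> be nearly on a geodesic from \<open>x\<close> to \<open>x'\<close>. Then \<open>\<mu>\<^sub>x(a)\<close>
  sits at distance about \<open>step\<close> from \<open>a\<close> in the direction of \<open>x\<close> and \<open>\<mu>\<^sub>x\<^sub>'(a)\<close> in the
  direction of \<open>x'\<close>; a common support point would be a shortcut from \<open>x\<close> to \<open>x'\<close>
  (\<open>flow_disjoint\<close>). Such \<open>a\<close> can be found at every distance from \<open>x\<close>, up to \<open>\<delta>\<close>, so
  their number grows linearly in \<open>d(x, x')\<close>.
\<close>

section \<open>The \<open>\<ell>\<^sup>1\<close>-distance of probability mass functions\<close>

abbreviation l1_dist :: "'a pmf \<Rightarrow> 'a pmf \<Rightarrow> real" where
  "l1_dist p q \<equiv> l1_norm (\<lambda>y. pmf p y - pmf q y)"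

lemma pmf_has_sum: "(pmf p has_sum 1) UNIV"
proof -
  have *: "pmf p abs_summable_on UNIV" by auto
  then have "Infinite_Sum.abs_summable_on (pmf p) UNIV"
    by (simp only: abs_summable_equivalent)
  then have "pmf p summable_on UNIV" by simp
  moreover have "infsum (pmf p) UNIV = 1"
    using infsetsum_infsum[OF *] infsetsum_pmf_eq_1[of p UNIV] by simp
  ultimately show ?thesis by (metis has_sum_infsum)
qed

lemma l1_dist_has_sum: "((\<lambda>y. \<bar>pmf p y - pmf q y\<bar>) has_sum l1_dist p q) UNIV"
proof -
  have "(\<lambda>y. pmf p y + pmf q y) summable_on UNIV"
    by (intro summable_on_add) (use pmf_has_sum in \<open>auto simp: summable_on_def\<close>)
  then have "(\<lambda>y. \<bar>pmf p y - pmf q y\<bar>) summable_on UNIV"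
    by (rule summable_on_comparison_test) (simp_all add: abs_diff_le_iff abs_le_iff)
  then show ?thesis unfolding l1_norm_def by (rule has_sum_infsum)
qed

lemma l1_dist_le_2: "l1_dist p q \<le> 2"
proof -
  have "((\<lambda>y. pmf p y + pmf q y) has_sum (1 + 1)) UNIV"
    by (intro has_sum_add pmf_has_sum)
  from has_sum_mono[OF l1_dist_has_sum this] show ?thesis by (simp add: abs_le_iff)
qed

lemma l1_dist_disjoint:
  assumes "set_pmf p \<inter> set_pmf q = {}"
  shows "l1_dist p q = 2"
proof -
  have "\<bar>pmf p y - pmf q y\<bar> = pmf p y + pmf q y" for y
  proof -
    have "pmf p y = 0 \<or> pmf q y = 0" using assms by (auto simp: set_pmf_eq)
    then show ?thesis by auto
  qed
  moreover have "((\<lambda>y. pmf p y + pmf q y) has_sum (1 + 1)) UNIV"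
    by (intro has_sum_add pmf_has_sum)
  ultimately show ?thesis
    using has_sum_unique[OF l1_dist_has_sum[of p q]] by fastforce
qed

lemma has_sum_finite_sum:
  fixes f :: "'i \<Rightarrow> 'a \<Rightarrow> real"
  assumes "finite I" "\<And>i. i \<in> I \<Longrightarrow> (f i has_sum s i) S"
  shows "((\<lambda>y. \<Sum>i\<in>I. f i y) has_sum (\<Sum>i\<in>I. s i)) S"
  using assms by (induction I rule: finite_induct) (auto intro!: has_sum_add)

text \<open>
  The convexity of the norm, for the independent coupling of two finite mixtures. The independent
  coupling is far from optimal, but it already sees a common component (see
  \<open>l1_dist_bind_contract\<close>).
\<close>

lemma l1_dist_bind_le:
  assumes A: "finite A" "A \<noteq> {}" and B: "finite B" "B \<noteq> {}"
  shows "l1_dist (bind_pmf (pmf_of_set A) f) (bind_pmf (pmf_of_set B) g)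
    \<le> (\<Sum>i\<in>A \<times> B. l1_dist (f (fst i)) (g (snd i))) / (card A * card B)"
    (is "l1_dist ?p ?q \<le> _")
proof -
  let ?c = "real (card A * card B)"
  have pos: "real (card A) > 0" "real (card B) > 0" using A B by (auto simp: card_gt_0_iff)
  have le: "\<bar>pmf ?p y - pmf ?q y\<bar>
    \<le> (1 / ?c) * (\<Sum>i\<in>A \<times> B. \<bar>pmf (f (fst i)) y - pmf (g (snd i)) y\<bar>)" for y
  proof -
    have "(\<Sum>i\<in>A \<times> B. pmf (f (fst i)) y - pmf (g (snd i)) y)
      = (\<Sum>z\<in>A. \<Sum>z'\<in>B. pmf (f z) y - pmf (g z') y)"
      by (simp add: sum.cartesian_product case_prod_unfold)
    also have "\<dots> = card B * (\<Sum>z\<in>A. pmf (f z) y) - card A * (\<Sum>z'\<in>B. pmf (g z') y)"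
      by (simp add: sum_subtractf sum_distrib_left)
    finally have "pmf ?p y - pmf ?q y
      = (1 / ?c) * (\<Sum>i\<in>A \<times> B. pmf (f (fst i)) y - pmf (g (snd i)) y)"
      using A B pos by (simp add: pmf_bind_pmf_of_set field_simps)
    then have "\<bar>pmf ?p y - pmf ?q y\<bar>
      = (1 / ?c) * \<bar>\<Sum>i\<in>A \<times> B. pmf (f (fst i)) y - pmf (g (snd i)) y\<bar>"
      by (simp add: abs_mult)
    also have "\<dots> \<le> (1 / ?c) * (\<Sum>i\<in>A \<times> B. \<bar>pmf (f (fst i)) y - pmf (g (snd i)) y\<bar>)"
      by (intro mult_left_mono sum_abs) simp
    finally show ?thesis .
  qed
  have "((\<lambda>y. (1 / ?c) * (\<Sum>i\<in>A \<times> B. \<bar>pmf (f (fst i)) y - pmf (g (snd i)) y\<bar>))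
    has_sum (1 / ?c) * (\<Sum>i\<in>A \<times> B. l1_dist (f (fst i)) (g (snd i)))) UNIV"
    using A B by (intro has_sum_cmult_right has_sum_finite_sum l1_dist_has_sum) auto
  from has_sum_mono[OF l1_dist_has_sum this le] show ?thesis by simp
qed

lemma l1_dist_bind_bound:
  assumes A: "finite A" "A \<noteq> {}" and B: "finite B" "B \<noteq> {}"
    and c: "\<And>z z'. z \<in> A \<Longrightarrow> z' \<in> B \<Longrightarrow> l1_dist (f z) (g z') \<le> c"
  shows "l1_dist (bind_pmf (pmf_of_set A) f) (bind_pmf (pmf_of_set B) g) \<le> c"
proof -
  have pos: "0 < real (card A * card B)" using A B by (auto simp: card_gt_0_iff)
  have "(\<Sum>i\<in>A \<times> B. l1_dist (f (fst i)) (g (snd i))) \<le> real (card (A \<times> B)) * c"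
    by (rule sum_bounded_above) (use c in auto)
  then have "(\<Sum>i\<in>A \<times> B. l1_dist (f (fst i)) (g (snd i))) / (card A * card B) \<le> c"
    using pos by (simp add: card_cartesian_product divide_le_eq mult.commute)
  then show ?thesis using l1_dist_bind_le[OF A B, of f g] by linarith
qed

text \<open>Doeblin's argument: a component shared by both mixtures is chosen twice, and then contributes
  nothing, with probability at least \<open>1 / K\<^sup>2\<close>.\<close>

lemma l1_dist_bind_contract:
  assumes A: "finite A" "card A \<le> K" and B: "finite B" "card B \<le> K"
    and w: "w \<in> A" "w \<in> B" and "0 \<le> c"
    and c: "\<And>z z'. z \<in> A \<Longrightarrow> z' \<in> B \<Longrightarrow> l1_dist (f z) (f z') \<le> c"
  shows "l1_dist (bind_pmf (pmf_of_set A) f) (bind_pmf (pmf_of_set B) f) \<le> (1 - 1 / real K ^ 2) * c"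
proof -
  have ne: "A \<noteq> {}" "B \<noteq> {}" using w by auto
  let ?n = "real (card A * card B)"
  have n1: "1 \<le> card A * card B" using A(1) B(1) ne by (auto simp: Suc_le_eq card_gt_0_iff)
  then have pos: "0 < ?n" by linarith
  have fin: "finite (A \<times> B)" and ww: "(w, w) \<in> A \<times> B" using A B w by auto
  have "(\<Sum>i\<in>A \<times> B. l1_dist (f (fst i)) (f (snd i)))
    = (\<Sum>i\<in>A \<times> B - {(w, w)}. l1_dist (f (fst i)) (f (snd i)))"
    using sum.remove[OF fin ww, of "\<lambda>i. l1_dist (f (fst i)) (f (snd i))"]
    by (simp add: l1_norm_def)
  also have "\<dots> \<le> real (card (A \<times> B - {(w, w)})) * c"
    by (rule sum_bounded_above) (use c in auto)
  also have "\<dots> = (?n - 1) * c"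
    using fin ww n1 by (simp add: card_Diff_singleton card_cartesian_product of_nat_diff del: of_nat_mult)
  finally have sum_le: "(\<Sum>i\<in>A \<times> B. l1_dist (f (fst i)) (f (snd i))) \<le> (?n - 1) * c" .
  have "l1_dist (bind_pmf (pmf_of_set A) f) (bind_pmf (pmf_of_set B) f)
    \<le> (\<Sum>i\<in>A \<times> B. l1_dist (f (fst i)) (f (snd i))) / ?n"
    by (rule l1_dist_bind_le[OF A(1) ne(1) B(1) ne(2)])
  also have "\<dots> \<le> (?n - 1) * c / ?n"
    by (rule divide_right_mono[OF sum_le]) simp
  also have "\<dots> = (1 - 1 / ?n) * c"
    using pos by (simp add: field_simps del: of_nat_mult)
  also have "\<dots> \<le> (1 - 1 / real K ^ 2) * c"
  proof (intro mult_right_mono diff_left_mono divide_left_mono)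
    have "card A * card B \<le> K * K" using A B by (intro mult_le_mono) auto
    then show "?n \<le> real K ^ 2" by (metis of_nat_le_iff of_nat_mult power2_eq_square)
    then show "0 < real K ^ 2 * ?n" using pos by (smt (verit) mult_pos_pos)
  qed (use \<open>0 \<le> c\<close> in auto)
  finally show ?thesis .
qed

section \<open>Points near geodesics\<close>

text \<open>
  The hypotheses with a single constant. The lower bounds on \<open>\<delta>\<close> and \<open>K\<close> serve to make the
  spacing \<open>2 * \<delta>\<close> of points on a geodesic and the contraction factor \<open>1 - 1 / K\<^sup>2\<close> positive.
\<close>

locale coarse_hyperbolic =
  fixes \<delta> :: real and K :: nat and X :: "'a::metric_space itself"
  assumes \<delta>_ge_1: "1 \<le> \<delta>" and K_ge_2: "2 \<le> K"
    and delta_hyperbolic: "delta_hyperbolic \<delta> X"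
    and coarse_geodesic: "\<And>(x :: 'a) y s. 0 \<le> s \<Longrightarrow> s \<le> dist x y
      \<Longrightarrow> \<exists>z. dist x z \<le> s \<and> dist z y \<le> dist x y - s + \<delta>"
    and finite_cball: "\<And>(x :: 'a) r. finite (cball x r)"
    and card_cball: "\<And>x :: 'a. card (cball x (3 * \<delta>)) \<le> K"
begin

lemma four_point:
  fixes x1 x2 x3 x4 :: 'a
  shows "dist x1 x4 + dist x2 x3 \<le> max (dist x1 x2 + dist x3 x4) (dist x1 x3 + dist x2 x4) + \<delta>"
  using delta_hyperbolic unfolding delta_hyperbolic_def by blast

definition near_geod :: "'a \<Rightarrow> 'a \<Rightarrow> real \<Rightarrow> real \<Rightarrow> 'a set" where
  "near_geod a x r e = {z. dist a z \<le> r \<and> dist z x \<le> dist a x - r + e}"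

lemma near_geod_mono: "e \<le> e' \<Longrightarrow> near_geod a x r e \<subseteq> near_geod a x r e'"
  by (auto simp: near_geod_def)

lemma near_geod_dist_ge: "z \<in> near_geod a x r e \<Longrightarrow> r - e \<le> dist a z"
  using dist_triangle[of a x z] by (auto simp: near_geod_def)

lemma near_geod_nonempty:
  assumes "0 \<le> r" "r \<le> dist a x"
  shows "near_geod a x r \<delta> \<noteq> {}"
  using coarse_geodesic[OF assms] by (auto simp: near_geod_def)

lemma finite_near_geod: "finite (near_geod a x r e)"
  by (rule finite_subset[OF _ finite_cball[of a r]]) (auto simp: near_geod_def)

text \<open>Geodesics between the same endpoints fellow-travel.\<close>

lemma near_geod_diam:
  assumes "z \<in> near_geod a x r e" "z' \<in> near_geod a x r e"
  shows "dist z z' \<le> e + \<delta>"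
  using assms four_point[of z z' a x] by (auto simp: near_geod_def dist_commute)

text \<open>
  Up to distance the Gromov product of \<open>x\<close> and \<open>x'\<close> based at \<open>a\<close>, the geodesics from \<open>a\<close> to
  \<open>x\<close> and to \<open>x'\<close> fellow-travel. Hyperbolicity enters through this lemma and
  \<open>near_geod_diam\<close> only.
\<close>

lemma near_geod_rebase:
  assumes "z \<in> near_geod a x r e" "0 \<le> e" "2 * r \<le> dist a x + dist a x' - dist x x'"
  shows "z \<in> near_geod a x' r (e + \<delta>)"
  using assms four_point[of z x' x a] by (auto simp: near_geod_def dist_commute)

lemma near_geod_close:
  assumes "z \<in> near_geod a x r e" "z' \<in> near_geod a x' r e" "0 \<le> e"
    and "2 * r \<le> dist a x + dist a x' - dist x x'"
  shows "dist z z' \<le> e + 2 * \<delta>"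
proof -
  have "z \<in> near_geod a x' r (e + \<delta>)"
    by (rule near_geod_rebase[OF assms(1,3,4)])
  moreover have "z' \<in> near_geod a x' r (e + \<delta>)"
    using assms(2) near_geod_mono[of e "e + \<delta>"] \<delta>_ge_1 by auto
  ultimately show ?thesis using near_geod_diam[of z a x' r "e + \<delta>" z'] by linarith
qed

lemma near_geod_meet:
  assumes "0 \<le> r" "r \<le> dist a x" "2 * r \<le> dist a x + dist a x' - dist x x'"
  obtains w where "w \<in> near_geod a x r (2 * \<delta>)" "w \<in> near_geod a x' r (2 * \<delta>)"
proof -
  obtain w where w: "w \<in> near_geod a x r \<delta>"
    using near_geod_nonempty[OF assms(1,2)] by auto
  have "w \<in> near_geod a x r (2 * \<delta>)"
    using w near_geod_mono[of \<delta> "2 * \<delta>"] \<delta>_ge_1 by auto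
  moreover have "w \<in> near_geod a x' r (2 * \<delta>)"
    using near_geod_rebase[OF w _ assms(3)] \<delta>_ge_1 by simp
  ultimately show ?thesis by (rule that)
qed

text \<open>
  The bound does not depend on \<open>dist a x\<close>, because the set has diameter at most \<open>3 * \<delta>\<close>.
\<close>

lemma card_near_geod: "card (near_geod a x r (2 * \<delta>)) \<le> K"
proof (cases "near_geod a x r (2 * \<delta>) = {}")
  case False
  then obtain z where z: "z \<in> near_geod a x r (2 * \<delta>)" by auto
  have "near_geod a x r (2 * \<delta>) \<subseteq> cball z (3 * \<delta>)"
    using near_geod_diam[OF z] by auto
  then have "card (near_geod a x r (2 * \<delta>)) \<le> card (cball z (3 * \<delta>))"
    by (rule card_mono[OF finite_cball])
  then show ?thesis using card_cball[of z] by linarith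
qed simp

section \<open>The random walk towards a point\<close>

text \<open>The factor \<open>6\<close> is large enough for two \<open>5 * \<delta>\<close>-close points of one level to have a
  Gromov product above the next lower level.\<close>

definition step :: real where
  "step = 6 * \<delta>"

lemma step_pos: "0 < step"
  using \<delta>_ge_1 by (simp add: step_def)

definition target :: "'a \<Rightarrow> nat \<Rightarrow> 'a \<Rightarrow> 'a set" where
  "target a n y = near_geod a y (step * real n) (2 * \<delta>)"

text \<open>
  The first jump of \<open>flow a n y\<close> goes to level \<open>n\<close> and the last one to level \<open>1\<close>. At an
  intermediate stage \<open>y\<close> lies on level \<open>n + 1\<close>, hence the shift by one in the lemmas below.
\<close>

primrec flow :: "'a \<Rightarrow> nat \<Rightarrow> 'a \<Rightarrow> 'a pmf" where
  "flow a 0 y = return_pmf y"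
| "flow a (Suc n) y = bind_pmf (pmf_of_set (target a (Suc n) y)) (\<lambda>z. flow a n z)"

lemma finite_target: "finite (target a n y)"
  by (simp add: target_def finite_near_geod)

lemma target_nonempty:
  assumes "step * real n \<le> dist a y"
  shows "target a n y \<noteq> {}"
proof -
  have "near_geod a y (step * real n) \<delta> \<noteq> {}"
    using assms step_pos by (intro near_geod_nonempty) auto
  then show ?thesis
    using near_geod_mono[of \<delta> "2 * \<delta>"] \<delta>_ge_1 by (force simp: target_def)
qed

text \<open>The deviations from a geodesic do not add up along the walk: hyperbolicity absorbs the
  deviation made on the previous levels.\<close>

lemma chain_step:
  assumes z: "z \<in> near_geod a x (step * real (Suc n)) (3 * \<delta>)" and z': "z' \<in> target a n z"
  shows "z' \<in> near_geod a x (step * real n) (3 * \<delta>)"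
proof -
  have "2 * (step * real n) \<le> dist a z + dist a x - dist z x"
    using near_geod_dist_ge[OF z] z \<delta>_ge_1
    by (auto simp: near_geod_def step_def algebra_simps)
  from near_geod_rebase[OF z'[unfolded target_def] _ this] show ?thesis
    using \<delta>_ge_1 by simp
qed

lemma target_subset: "target a n x \<subseteq> near_geod a x (step * real n) (3 * \<delta>)"
  unfolding target_def by (rule near_geod_mono) (use \<delta>_ge_1 in simp)

lemma level_le:
  assumes "z \<in> near_geod a x (step * real (Suc n)) (3 * \<delta>)"
  shows "step * real n \<le> dist a z"
  using near_geod_dist_ge[OF assms] \<delta>_ge_1 by (simp add: step_def algebra_simps)

lemma target_level_le: "z \<in> target a (Suc n) y \<Longrightarrow> step * real n \<le> dist a z"
  using target_subset level_le by blast

lemma flow_support: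
  assumes "y \<in> near_geod a x (step * real (Suc n)) (3 * \<delta>)" "p \<in> set_pmf (flow a n y)"
  shows "p \<in> near_geod a x step (3 * \<delta>)"
  using assms
proof (induction n arbitrary: y)
  case (Suc n)
  have ne: "target a (Suc n) y \<noteq> {}"
    using level_le[OF Suc.prems(1)] by (rule target_nonempty)
  then obtain z where "z \<in> target a (Suc n) y" "p \<in> set_pmf (flow a n z)"
    using Suc.prems(2) by (auto simp: set_pmf_of_set[OF ne finite_target])
  then show ?case using Suc.IH chain_step[OF Suc.prems(1)] by blast
qed simp

lemma flow_support_start:
  assumes "1 \<le> n" "step * real n \<le> dist a x" "p \<in> set_pmf (flow a n x)"
  shows "p \<in> near_geod a x step (3 * \<delta>)"
proof -
  obtain m where n: "n = Suc m" using assms(1) by (cases n) auto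
  have ne: "target a (Suc m) x \<noteq> {}"
    using assms(2) n by (intro target_nonempty) simp
  then obtain z where "z \<in> target a (Suc m) x" "p \<in> set_pmf (flow a m z)"
    using assms(3) n by (auto simp: set_pmf_of_set[OF ne finite_target])
  then show ?thesis using flow_support target_subset by blast
qed

lemma flow_isometry:
  fixes g :: "'a \<Rightarrow> 'a"
  assumes "bij g" and iso: "\<And>x y. dist (g x) (g y) = dist x y"
    and "step * real n \<le> dist a y"
  shows "flow (g a) n (g y) = map_pmf g (flow a n y)"
  using assms(3)
proof (induction n arbitrary: y)
  case (Suc n)
  have "target (g a) (Suc n) (g y) = g ` target a (Suc n) y"
  proof (rule Set.set_eqI)
    fix w
    obtain v where w: "w = g v" using \<open>bij g\<close> by (metis bij_pointE)
    show "w \<in> target (g a) (Suc n) (g y) \<longleftrightarrow> w \<in> g ` target a (Suc n) y"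
      using inj_image_mem_iff[OF bij_is_inj[OF \<open>bij g\<close>], of v]
      by (simp add: w target_def near_geod_def iso)
  qed
  moreover have ne: "target a (Suc n) y \<noteq> {}" using Suc.prems by (rule target_nonempty)
  ultimately have
    "pmf_of_set (target (g a) (Suc n) (g y)) = map_pmf g (pmf_of_set (target a (Suc n) y))"
    using \<open>bij g\<close>
    by (simp add: map_pmf_of_set_inj finite_target bij_is_inj inj_on_subset[OF bij_is_inj])
  then show ?case
    using Suc.IH target_level_le
    by (auto simp: bind_map_pmf map_bind_pmf set_pmf_of_set[OF ne finite_target]
        intro!: bind_pmf_cong)
qed simp

section \<open>Exponential forgetting of the starting point\<close>

definition \<rho> :: real where
  "\<rho> = 1 - 1 / real K ^ 2"

lemma \<rho>_bounds: "0 < \<rho>" "\<rho> < 1"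
proof -
  have "(2::real) ^ 2 \<le> real K ^ 2" using K_ge_2 by (intro power_mono) auto
  then have "1 < real K ^ 2" by simp
  then have "0 < 1 / real K ^ 2" "1 / real K ^ 2 < 1" using K_ge_2 by (auto simp: divide_less_eq)
  then show "0 < \<rho>" "\<rho> < 1" by (auto simp: \<rho>_def)
qed

definition rate :: real where
  "rate = - ln \<rho> / step"

lemma rate_pos: "0 < rate"
  using \<rho>_bounds step_pos by (simp add: rate_def divide_neg_pos)

text \<open>
  The hypothesis of \<open>5 * \<delta>\<close>-closeness reproduces itself: close \<open>y\<close> and \<open>y'\<close> have a large Gromov
  product, so their targets not only meet but lie within \<open>4 * \<delta>\<close> of each other, and each level
  yields another factor \<open>\<rho>\<close>.
\<close>

lemma flow_contraction:
  assumes "step * real (Suc n) - 3 * \<delta> \<le> dist a y" "step * real (Suc n) - 3 * \<delta> \<le> dist a y'"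
    and "dist y y' \<le> 5 * \<delta>"
  shows "l1_dist (flow a n y) (flow a n y') \<le> 2 * \<rho> ^ n"
  using assms
proof (induction n arbitrary: y y')
  case 0
  then show ?case using l1_dist_le_2 by (simp del: flow.simps)
next
  case (Suc n)
  let ?r = "step * real (Suc n)"
  have r: "0 \<le> ?r" "?r \<le> dist a y" "2 * ?r \<le> dist a y + dist a y' - dist y y'"
    using Suc.prems \<delta>_ge_1 by (auto simp: step_def algebra_simps)
  obtain w where w: "w \<in> target a (Suc n) y" "w \<in> target a (Suc n) y'"
    using near_geod_meet[OF r] unfolding target_def by blast
  have IH: "l1_dist (flow a n z) (flow a n z') \<le> 2 * \<rho> ^ n"
    if z: "z \<in> target a (Suc n) y" and z': "z' \<in> target a (Suc n) y'" for z z'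
  proof (rule Suc.IH)
    show "?r - 3 * \<delta> \<le> dist a z" "?r - 3 * \<delta> \<le> dist a z'"
      using z z' target_subset near_geod_dist_ge by blast+
    show "dist z z' \<le> 5 * \<delta>"
      using near_geod_close[OF z[unfolded target_def] z'[unfolded target_def] _ r(3)] \<delta>_ge_1
      by simp
  qed
  have "l1_dist (flow a (Suc n) y) (flow a (Suc n) y') \<le> (1 - 1 / real K ^ 2) * (2 * \<rho> ^ n)"
    unfolding flow.simps
    by (rule l1_dist_bind_contract[OF finite_target _ finite_target _ w _ IH])
      (use card_near_geod \<rho>_bounds in \<open>auto simp: target_def\<close>)
  then show ?case by (simp add: \<rho>_def)
qed

text \<open>The law of the walk is a mixture over its position at any intermediate level.\<close>

lemma flow_mixture:
  assumes c: "\<And>z. z \<in> near_geod a x (step * real (Suc m)) (3 * \<delta>) \<Longrightarrow> l1_dist (flow a m z) q \<le> c"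
    and "Suc m \<le> n" "step * real n \<le> dist a x"
  shows "l1_dist (flow a n x) q \<le> c"
proof -
  have bind: "l1_dist (flow a (Suc k) y) q \<le> c"
    if "step * real (Suc k) \<le> dist a y" "\<And>z. z \<in> target a (Suc k) y \<Longrightarrow> l1_dist (flow a k z) q \<le> c"
    for k y
  proof -
    have "l1_dist (bind_pmf (pmf_of_set (target a (Suc k) y)) (flow a k))
      (bind_pmf (pmf_of_set {a}) (\<lambda>_. q)) \<le> c"
      using that by (intro l1_dist_bind_bound finite_target target_nonempty) auto
    then show ?thesis by simp
  qed
  have chain: "l1_dist (flow a (m + k) y) q \<le> c"
    if "y \<in> near_geod a x (step * real (Suc (m + k))) (3 * \<delta>)" for k y
    using that
  proof (induction k arbitrary: y)
    case 0
    then show ?case using c by simp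
  next
    case (Suc k)
    show ?case
      using bind[of "m + k" y] Suc.IH chain_step[of y a x "Suc (m + k)"] level_le[of y a x "Suc (m + k)"]
        Suc.prems by simp
  qed
  obtain k where n: "n = Suc (m + k)" using assms(2) by (metis add_Suc less_eqE)
  show ?thesis
    unfolding n
  proof (rule bind)
    show "step * real (Suc (m + k)) \<le> dist a x" using assms(3) n by simp
  qed (use chain target_subset in blast)
qed

lemma flow_forget:
  assumes "Suc m \<le> n" "step * real n \<le> dist a x" "Suc m \<le> n'" "step * real n' \<le> dist a x'"
    and prod: "2 * (step * real (Suc m)) \<le> dist a x + dist a x' - dist x x'"
  shows "l1_dist (flow a n x) (flow a n' x') \<le> 2 * \<rho> ^ m"
proof (rule flow_mixture[OF _ assms(1,2)])
  fix z assume z: "z \<in> near_geod a x (step * real (Suc m)) (3 * \<delta>)"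
  have sym: "l1_dist p q = l1_dist q p" for p q :: "'a pmf"
    by (simp add: l1_norm_def abs_minus_commute)
  have "l1_dist (flow a n' x') (flow a m z) \<le> 2 * \<rho> ^ m"
  proof (rule flow_mixture[OF _ assms(3,4)])
    fix z' assume z': "z' \<in> near_geod a x' (step * real (Suc m)) (3 * \<delta>)"
    show "l1_dist (flow a m z') (flow a m z) \<le> 2 * \<rho> ^ m"
    proof (rule flow_contraction)
      show "dist z' z \<le> 5 * \<delta>"
        using near_geod_close[OF z z' _ prod] \<delta>_ge_1 by (simp add: dist_commute)
    qed (use z z' near_geod_dist_ge in blast)+
  qed
  then show "l1_dist (flow a m z) (flow a n' x') \<le> 2 * \<rho> ^ m" by (simp add: sym)
qed

section \<open>The equivariant map\<close>

definition level :: "'a \<Rightarrow> 'a \<Rightarrow> nat" where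
  "level a x = nat \<lfloor>dist a x / step\<rfloor>"

definition \<mu> :: "'a \<Rightarrow> 'a \<Rightarrow> 'a pmf" where
  "\<mu> x a = flow a (level a x) x"

lemma le_level_iff: "n \<le> level a x \<longleftrightarrow> step * real n \<le> dist a x"
proof -
  have "n \<le> level a x \<longleftrightarrow> real n \<le> dist a x / step"
    using step_pos by (simp add: level_def le_nat_iff le_floor_iff)
  then show ?thesis using step_pos by (simp add: pos_le_divide_eq mult.commute)
qed

lemma level_le_dist: "step * real (level a x) \<le> dist a x"
  using le_level_iff by blast

lemma \<mu>_isometry:
  assumes "bij g" "\<And>x y. dist (g x) (g y) = dist x y"
  shows "\<mu> (g x) (g a) = map_pmf g (\<mu> x a)"
  using flow_isometry[OF assms level_le_dist] by (simp add: \<mu>_def level_def assms(2))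

lemma \<mu>_near_geod:
  assumes "step \<le> dist a x" "p \<in> set_pmf (\<mu> x a)"
  shows "p \<in> near_geod a x step (3 * \<delta>)"
  using flow_support_start[OF _ level_le_dist, of a x p] assms le_level_iff[of 1 a x]
  by (simp add: \<mu>_def)

lemma \<mu>_support: "set_pmf (\<mu> x a) \<subseteq> cball a step"
proof (cases "step \<le> dist a x")
  case True
  then show ?thesis using \<mu>_near_geod by (auto simp: near_geod_def)
next
  case False
  then have "level a x = 0" using le_level_iff[of 1 a x] by simp
  then show ?thesis using False by (simp add: \<mu>_def)
qed

text \<open>
  The rate turns the contraction factor per level into one per unit of distance. The factor
  \<open>2 * exp (rate * (k + 2 * step))\<close> pays for the at most \<open>k / step + 2\<close> levels of
  \<open>x\<close> on which nothing is gained.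
\<close>

lemma \<mu>_forget:
  assumes "dist x x' \<le> k"
  shows "l1_dist (\<mu> x a) (\<mu> x' a) \<le> 2 * exp (rate * (k + 2 * step)) * exp (- rate * dist x a)"
proof -
  have eq: "2 * exp (rate * (k + 2 * step)) * exp (- rate * dist x a)
    = 2 * exp (rate * (k + 2 * step - dist a x))"
    by (simp add: exp_add[symmetric] algebra_simps dist_commute)
  show ?thesis
  proof (cases "k + step \<le> dist a x")
    case False
    then have "0 \<le> rate * (k + 2 * step - dist a x)" using rate_pos step_pos by simp
    then have "1 \<le> exp (rate * (k + 2 * step - dist a x))" by simp
    then show ?thesis using l1_dist_le_2[of "\<mu> x a" "\<mu> x' a"] unfolding eq by linarith
  next
    case True
    define j where "j = nat \<lfloor>(dist a x - k) / step\<rfloor>"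
    have ge1: "1 \<le> (dist a x - k) / step" using True step_pos by (simp add: field_simps)
    then have "1 \<le> j" by (simp add: j_def le_nat_iff)
    then obtain m where m: "j = Suc m" by (cases j) auto
    have "real j \<le> (dist a x - k) / step" "(dist a x - k) / step < real j + 1"
      using ge1 unfolding j_def by linarith+
    then have j: "step * real (Suc m) \<le> dist a x - k" "dist a x - k < step * (real m + 2)"
      using step_pos m by (auto simp: field_simps)
    have tri: "dist a x \<le> dist a x' + dist x x'"
      by (metis dist_commute dist_triangle)
    have "0 \<le> k" using assms zero_le_dist[of x x'] by linarith
    have "l1_dist (\<mu> x a) (\<mu> x' a) \<le> 2 * \<rho> ^ m"
      unfolding \<mu>_def
    proof (rule flow_forget[OF _ level_le_dist _ level_le_dist])
      show "Suc m \<le> level a x" "Suc m \<le> level a x'"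
        using j(1) tri assms \<open>0 \<le> k\<close> unfolding le_level_iff by linarith+
      show "2 * (step * real (Suc m)) \<le> dist a x + dist a x' - dist x x'"
        using j(1) tri assms by linarith
    qed
    also have "\<rho> ^ m = exp (rate * (- (step * real m)))"
      using \<rho>_bounds step_pos by (simp add: rate_def exp_of_nat_mult mult.commute)
    also have "\<dots> \<le> exp (rate * (k + 2 * step - dist a x))"
      unfolding exp_le_cancel_iff
      by (rule mult_left_mono) (use j(2) rate_pos in \<open>auto simp: algebra_simps\<close>)
    finally show ?thesis unfolding eq by simp
  qed
qed

text \<open>A common support point would be closer to \<open>x\<close> and to \<open>x'\<close> than \<open>a\<close> is, by about \<open>step\<close>
  each time, which is more than the triangle inequality for \<open>x\<close> and \<open>x'\<close> allows.\<close>

lemma flow_disjoint: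
  assumes "step \<le> dist a x" "step \<le> dist a x'" "dist a x + dist a x' \<le> dist x x' + \<delta>"
  shows "set_pmf (\<mu> x a) \<inter> set_pmf (\<mu> x' a) = {}"
proof (rule ccontr)
  assume "\<not> ?thesis"
  then obtain z where "z \<in> near_geod a x step (3 * \<delta>)" "z \<in> near_geod a x' step (3 * \<delta>)"
    using \<mu>_near_geod assms by blast
  moreover have "dist x x' \<le> dist z x + dist z x'" by (metis dist_commute dist_triangle)
  ultimately show False using assms(3) \<delta>_ge_1 by (auto simp: near_geod_def step_def)
qed

text \<open>By the exponential decay, disjointness of the supports forces \<open>a\<close> to be near \<open>x\<close>.
  Finiteness matters because \<open>card\<close> is \<open>0\<close> on infinite sets.\<close>

lemma finite_disjoint: "finite {a. set_pmf (\<mu> x a) \<inter> set_pmf (\<mu> x' a) = {}}"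
proof -
  define C where "C = 2 * exp (rate * (dist x x' + 2 * step))"
  have "{a. set_pmf (\<mu> x a) \<inter> set_pmf (\<mu> x' a) = {}} \<subseteq> cball x (dist x x' + 2 * step)"
  proof clarify
    fix a assume "set_pmf (\<mu> x a) \<inter> set_pmf (\<mu> x' a) = {}"
    then have "2 \<le> C * exp (- rate * dist x a)"
      using \<mu>_forget[of x x' "dist x x'" a] l1_dist_disjoint[of "\<mu> x a" "\<mu> x' a"]
      by (simp add: C_def)
    also have "\<dots> = 2 * exp (rate * (dist x x' + 2 * step - dist x a))"
      by (simp add: C_def exp_add[symmetric] algebra_simps)
    finally have "0 \<le> rate * (dist x x' + 2 * step - dist x a)" by simp
    then show "a \<in> cball x (dist x x' + 2 * step)" using rate_pos by (simp add: zero_le_mult_iff)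
  qed
  then show ?thesis using finite_cball finite_subset by blast
qed

lemma card_disjoint:
  assumes D: "4 * step + 2 * \<delta> \<le> dist x x'"
  shows "dist x x' / (4 * \<delta>) \<le> real (card {a. set_pmf (\<mu> x a) \<inter> set_pmf (\<mu> x' a) = {}})"
proof -
  let ?d = "dist x x'"
  \<comment> \<open>Points at distance about \<open>s i\<close> from \<open>x\<close> on a geodesic to \<open>x'\<close>: their distances to \<open>x\<close> lie in
    disjoint intervals of length \<open>\<delta>\<close>.\<close>
  define s where "s i = step + \<delta> + 2 * \<delta> * real i" for i
  define N where "N = nat \<lfloor>(?d - 2 * step - \<delta>) / (2 * \<delta>)\<rfloor>"
  have N0: "0 \<le> (?d - 2 * step - \<delta>) / (2 * \<delta>)" using D \<delta>_ge_1 step_pos by simp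
  have "real N \<le> (?d - 2 * step - \<delta>) / (2 * \<delta>)" "(?d - 2 * step - \<delta>) / (2 * \<delta>) < real N + 1"
    using N0 unfolding N_def by linarith+
  then have N: "2 * \<delta> * real N \<le> ?d - 2 * step - \<delta>" "?d - 2 * step - \<delta> < 2 * \<delta> * (real N + 1)"
    using \<delta>_ge_1 by (auto simp: field_simps)
  have s: "0 \<le> s i" "s i \<le> ?d - step" if "i \<le> N" for i
  proof -
    have "2 * \<delta> * real i \<le> 2 * \<delta> * real N" using that \<delta>_ge_1 by simp
    then show "s i \<le> ?d - step" using N(1) by (simp add: s_def)
    show "0 \<le> s i" using step_pos \<delta>_ge_1 by (simp add: s_def)
  qed
  have "\<exists>a. dist x a \<le> s i \<and> dist a x' \<le> ?d - s i + \<delta>" if "i \<le> N" for i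
    using s[OF that] step_pos by (intro coarse_geodesic) auto
  then obtain b where b: "\<And>i. i \<le> N \<Longrightarrow> dist x (b i) \<le> s i \<and> dist (b i) x' \<le> ?d - s i + \<delta>"
    by metis
  have b_ge: "s i - \<delta> \<le> dist x (b i)" if "i \<le> N" for i
    using b[OF that] dist_triangle[of x x' "b i"] by linarith
  have "inj_on b {..N}"
  proof (rule linorder_inj_onI)
    fix i j assume ij: "i < j" "i \<in> {..N}" "j \<in> {..N}"
    have "2 * \<delta> * (real i + 1) \<le> 2 * \<delta> * real j" using ij \<delta>_ge_1 by (intro mult_left_mono) auto
    then have "s i + 2 * \<delta> \<le> s j" by (simp add: s_def algebra_simps)
    then have "dist x (b i) < dist x (b j)" using b[of i] b_ge[of j] ij \<delta>_ge_1 by auto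
    then show "b i \<noteq> b j" by auto
  qed auto
  moreover have "b ` {..N} \<subseteq> {a. set_pmf (\<mu> x a) \<inter> set_pmf (\<mu> x' a) = {}}"
  proof clarify
    fix i assume "i \<le> N"
    note bi = b[OF this] b_ge[OF this] s[OF this]
    have "step + \<delta> \<le> s i" using \<delta>_ge_1 by (simp add: s_def)
    show "set_pmf (\<mu> x (b i)) \<inter> set_pmf (\<mu> x' (b i)) = {}"
    proof (rule flow_disjoint)
      show "step \<le> dist (b i) x" using bi \<open>step + \<delta> \<le> s i\<close> by (simp add: dist_commute)
      show "step \<le> dist (b i) x'" using bi dist_triangle[of x x' "b i"] by linarith
      show "dist (b i) x + dist (b i) x' \<le> ?d + \<delta>" using bi by (simp add: dist_commute)
    qed
  qed
  ultimately have "card {..N} \<le> card {a. set_pmf (\<mu> x a) \<inter> set_pmf (\<mu> x' a) = {}}"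
    using finite_disjoint card_mono card_image by metis
  then have "real N + 1 \<le> real (card {a. set_pmf (\<mu> x a) \<inter> set_pmf (\<mu> x' a) = {}})"
    by simp
  moreover have "?d / (4 * \<delta>) \<le> real N + 1"
    using N(2) D \<delta>_ge_1 by (simp add: divide_le_eq algebra_simps)
  ultimately show ?thesis by linarith
qed

end

section \<open>A common constant, and conclusion\<close>

text \<open>Both conditions that involve \<open>\<delta>\<close> are monotone in it, hence the common constant.\<close>

lemma coarse_hyperbolic_exists:
  assumes "hyperbolic TYPE('a::metric_space)" "weakly_geodesic TYPE('a)"
    and ulf: "uniformly_locally_finite TYPE('a)"
  shows "\<exists>\<delta> K. coarse_hyperbolic \<delta> K TYPE('a)"
proof -
  obtain \<delta>1 where hyp: "delta_hyperbolic \<delta>1 TYPE('a)"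
    using assms(1) by (auto simp: hyperbolic_def)
  obtain \<delta>2 where \<delta>2: "0 \<le> \<delta>2" and geo: "weakly_delta_geodesic \<delta>2 TYPE('a)"
    using assms(2) by (auto simp: weakly_geodesic_def)
  define \<delta> where "\<delta> = max 1 (max \<delta>1 \<delta>2)"
  have \<delta>: "1 \<le> \<delta>" "\<delta>1 \<le> \<delta>" "\<delta>2 \<le> \<delta>" by (auto simp: \<delta>_def)
  obtain K0 :: nat where K0: "\<And>x::'a. card (cball x (3 * \<delta>)) \<le> K0"
    using ulf \<delta>(1) unfolding uniformly_locally_finite_def
    by (metis mult_nonneg_nonneg order_trans zero_le_numeral zero_le_one)
  have "coarse_hyperbolic \<delta> (K0 + 2) TYPE('a)"
  proof
    show "delta_hyperbolic \<delta> TYPE('a)"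
      using hyp \<delta>(2) unfolding delta_hyperbolic_def by (smt (verit))
    show "\<exists>z. dist x z \<le> s \<and> dist z y \<le> dist x y - s + \<delta>"
      if st: "0 \<le> s" "s \<le> dist x y" for x y :: 'a and s
    proof -
      obtain z where "dist x z \<le> s" "dist z y \<le> dist x y - s + \<delta>2"
        using geo[unfolded weakly_delta_geodesic_def, rule_format, of s x y] st \<delta>2 by auto
      then show ?thesis using \<delta>(3) by (intro exI[of _ z]) linarith
    qed
    show "finite (cball x r)" for x :: 'a and r
    proof (cases "0 \<le> r")
      case True
      then show ?thesis using ulf unfolding uniformly_locally_finite_def by blast
    qed simp
    show "card (cball x (3 * \<delta>)) \<le> K0 + 2" for x :: 'a
      using K0[of x] by linarith
  qed (use \<delta> in auto)
  then show ?thesis by blast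
qed

theorem mainTheorem2:
  fixes G :: "('g, 'm) monoid_scheme"
    and \<phi> :: "'g \<Rightarrow> 'a::metric_space \<Rightarrow> 'a"
  assumes "hyperbolic TYPE('a)"
    and "weakly_geodesic TYPE('a)"
    and "uniformly_locally_finite TYPE('a)"
    and "isometric_action G \<phi>"
  shows "\<exists>\<mu> :: 'a \<Rightarrow> 'a \<Rightarrow> 'a pmf. equivariant G \<phi> \<mu> \<and>
    (\<exists>R::nat. \<forall>a x. set_pmf (\<mu> x a) \<subseteq> cball a (real R)) \<and>
    (\<exists>\<epsilon>>0. \<forall>k::nat. \<exists>C>0. \<forall>x x' a. dist x x' \<le> real k \<longrightarrow>
      l1_norm (\<lambda>y. pmf (\<mu> x a) y - pmf (\<mu> x' a) y) \<le> C * exp (- \<epsilon> * dist x a)) \<and>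
    (\<exists>\<eta>>0. \<exists>D::real. \<forall>x x'. dist x x' \<ge> D \<longrightarrow>
      real (card {a. set_pmf (\<mu> x a) \<inter> set_pmf (\<mu> x' a) = {}}) \<ge> \<eta> * dist x x')"
proof -
  obtain \<delta> K where "coarse_hyperbolic \<delta> K TYPE('a)"
    using coarse_hyperbolic_exists assms(1-3) by blast
  then interpret coarse_hyperbolic \<delta> K "TYPE('a)" .
  have bij: "bij (\<phi> g)" and iso: "dist (\<phi> g x) (\<phi> g y) = dist x y"
    if "g \<in> carrier G" for g x y
  proof -
    have "group_action G UNIV \<phi>" using assms(4) by (simp add: isometric_action_def)
    then show "bij (\<phi> g)"
      using group_action.surj_prop group_action.inj_prop that by (metis bij_def)
    show "dist (\<phi> g x) (\<phi> g y) = dist x y"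
      using assms(4) that by (simp add: isometric_action_def)
  qed
  show ?thesis
  proof (intro exI[of _ \<mu>] conjI)
    show "equivariant G \<phi> \<mu>"
      using \<mu>_isometry[OF bij iso] by (simp add: equivariant_def)
    show "\<exists>R::nat. \<forall>a x. set_pmf (\<mu> x a) \<subseteq> cball a (real R)"
    proof (intro exI allI)
      fix a x :: 'a
      have "cball a step \<subseteq> cball a (real (nat \<lceil>step\<rceil>))"
        by (rule subset_cball) (rule real_nat_ceiling_ge)
      then show "set_pmf (\<mu> x a) \<subseteq> cball a (real (nat \<lceil>step\<rceil>))"
        using \<mu>_support by blast
    qed
    show "\<exists>\<epsilon>>0. \<forall>k::nat. \<exists>C>0. \<forall>x x' a. dist x x' \<le> real k \<longrightarrow>
      l1_norm (\<lambda>y. pmf (\<mu> x a) y - pmf (\<mu> x' a) y) \<le> C * exp (- \<epsilon> * dist x a)"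
    proof (rule exI[of _ rate], intro conjI allI)
      show "0 < rate" by (rule rate_pos)
      fix k :: nat
      show "\<exists>C>0. \<forall>x x' a. dist x x' \<le> real k \<longrightarrow>
        l1_norm (\<lambda>y. pmf (\<mu> x a) y - pmf (\<mu> x' a) y) \<le> C * exp (- rate * dist x a)"
        by (rule exI[of _ "2 * exp (rate * (real k + 2 * step))"])
          (use \<mu>_forget[of _ _ "real k"] in simp)
    qed
    show "\<exists>\<eta>>0. \<exists>D::real. \<forall>x x'. dist x x' \<ge> D \<longrightarrow>
      real (card {a. set_pmf (\<mu> x a) \<inter> set_pmf (\<mu> x' a) = {}}) \<ge> \<eta> * dist x x'"
    proof (rule exI[of _ "1 / (4 * \<delta>)"], intro conjI)
      show "\<exists>D::real. \<forall>x x'. dist x x' \<ge> D \<longrightarrow>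
        real (card {a. set_pmf (\<mu> x a) \<inter> set_pmf (\<mu> x' a) = {}}) \<ge> 1 / (4 * \<delta>) * dist x x'"
        using card_disjoint by (intro exI[of _ "4 * step + 2 * \<delta>"]) simp
    qed (use \<delta>_ge_1 in simp)
  qed
qed

end
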